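(* Let $\mathcal{X}\subset\mathbb{R}^n$ be a nonempty box, and let $f=(f_1,\dots,f_g):\mathbb{R}^n\to\mathbb{R}^g$ be continuously differentiable in $\mathcal{X}$ with $f(0)=0$. Then $f$ is locally quadratically bounded in $\mathcal{X}$, in the sense that $$\langle f(x),f(x)\rangle\le x^{\top}\Gamma^{\top}\Gamma x\qquad\text{for all } x\in\mathcal{X},$$ where $\Gamma\in\mathbb{R}^{n\times n}$ can be computed as the diagonal matrix $$\Gamma=\mathrm{Diag}\left(\left\{\max_{x\in\mathcal{X}}\sqrt{\,n\sum_{i=1}^{g}\Big(\frac{\partial f_i}{\partial x_j}(x)\Big)^2}\,\right\}_{j=1}^{n}\right).$$
   Context: A box in $\mathbb{R}^n$ is a product $\prod_{i=1}^n[a_i,b_i]$ of compact real intervals with known bounds. The function $f$ is the nonlinearity of a dynamic system $\dot x=Ax+Gf(x)+Bu$ with state $x\in\mathcal{X}$ and input $u$ (with $A,B,G$ constant matrices); it does not depend on $u$. $\langle\cdot,\cdot\rangle$ is the Euclidean inner product. $\mathrm{Diag}(\{d_j\}_{j=1}^n)$ is the $n\times n$ diagonal matrix with diagonal entries $d_1,\dots,d_n$.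
   Formalization: The box is additionally assumed to contain the origin; without this the claim is false: for n = g = 1, the box [1,2] and a smooth f with f(0) = 0 and f = 5 near [1,2], Γ = 0 and the bound would read 25 ≤ 0. *)

theory Defs
  imports "HOL-Analysis.Analysis"
begin

definition diag :: "('n \<Rightarrow> real) \<Rightarrow> real ^ 'n ^ 'n" where
  "diag d = (\<chi> i j. if i = j then d i else 0)"

definition partial_deriv :: "(real ^ 'n \<Rightarrow> real ^ 'g) \<Rightarrow> 'g \<Rightarrow> 'n \<Rightarrow> real ^ 'n \<Rightarrow> real" where
  "partial_deriv f i j x = deriv (\<lambda>t. f (x + t *\<^sub>R axis j 1) $ i) 0"

text \<open>The function is total, so differentiability at a boundary point of \<open>X\<close> is the usual two-sided
  notion; only continuity of the derivative is relative to \<open>X\<close>. No neighbourhood of \<open>X\<close> is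
  involved, and partial derivatives remain unique when some side of a box is a single point.\<close>

definition continuously_differentiable_in :: "(real ^ 'n \<Rightarrow> real ^ 'g) \<Rightarrow> (real ^ 'n) set \<Rightarrow> bool" where
  "continuously_differentiable_in f X \<longleftrightarrow>
     (\<forall>x\<in>X. f differentiable (at x)) \<and>
     (\<forall>i j. continuous_on X (partial_deriv f i j))"

definition has_maximum_on :: "('a \<Rightarrow> real) \<Rightarrow> 'a set \<Rightarrow> bool" where
  "has_maximum_on h X \<longleftrightarrow> (\<exists>x\<in>X. \<forall>y\<in>X. h y \<le> h x)"

text \<open>A genuine maximum rather than a supremum; the value is meaningful only
  together with \<^const>\<open>has_maximum_on\<close>.\<close>

definition maximum_on :: "('a \<Rightarrow> real) \<Rightarrow> 'a set \<Rightarrow> real" where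
  "maximum_on h X = (GREATEST m. m \<in> h ` X)"

definition quadratically_bounded_by :: "real ^ 'n ^ 'n \<Rightarrow> (real ^ 'n \<Rightarrow> real ^ 'g) \<Rightarrow> (real ^ 'n) set \<Rightarrow> bool" where
  "quadratically_bounded_by \<Gamma> f X \<longleftrightarrow>
     (\<forall>x\<in>X. f x \<bullet> f x \<le> x \<bullet> ((transpose \<Gamma> ** \<Gamma>) *v x))"

definition column_bound :: "(real ^ 'n \<Rightarrow> real ^ 'g) \<Rightarrow> 'n \<Rightarrow> real ^ 'n \<Rightarrow> real" where
  "column_bound f j x = sqrt (real CARD('n) * (\<Sum>i\<in>UNIV. (partial_deriv f i j x)\<^sup>2))"

end

theory Submission
  imports Defs
begin

text \<open>Each Jacobian column has squared norm at most \<open>(d j)\<^sup>2 / n\<close> on the box, where \<open>d j\<close> is the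
  diagonal entry of \<open>\<Gamma>\<close>. The mean value inequality along the segment from \<open>0\<close> to \<open>x\<close> bounds
  \<open>\<parallel>f x\<parallel>\<close> by \<open>\<parallel>J \<xi> x\<parallel>\<close>, and Cauchy--Schwarz for the sum of the \<open>n\<close> terms \<open>\<bar>x j\<bar> \<parallel>J \<xi> e j\<parallel>\<close>
  produces the factor \<open>n\<close>.\<close>

text \<open>The chain rule along the line t -> x + t e_j links the one-variable \<open>deriv\<close>
  in \<open>partial_deriv\<close> to the total derivative, so \<open>f' (axis j 1)\<close> is the
  j-th Jacobian column.\<close>

lemma has_derivative_partial_deriv:
  fixes f :: "real ^ 'n \<Rightarrow> real ^ 'g"
  assumes "(f has_derivative f') (at x)"
  shows "partial_deriv f i j x = f' (axis j 1) $ i"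
proof -
  have lin: "linear f'"
    using assms by (rule has_derivative_linear)
  have "((\<lambda>t::real. x + t *\<^sub>R axis j 1) has_derivative (\<lambda>t. t *\<^sub>R axis j 1)) (at 0)"
    by (auto intro!: derivative_eq_intros)
  from has_derivative_compose[OF this, of f f'] assms
  have "((\<lambda>t. f (x + t *\<^sub>R axis j 1)) has_derivative (\<lambda>t. f' (t *\<^sub>R axis j 1))) (at 0)"
    by simp
  from bounded_linear.has_derivative[OF bounded_linear_vec_nth this, of i]
  have "((\<lambda>t. f (x + t *\<^sub>R axis j 1) $ i) has_field_derivative f' (axis j 1) $ i) (at 0)"
    unfolding has_field_derivative_def
    by (simp add: linear_scale[OF lin] mult_commute_abs)
  then show ?thesis
    unfolding partial_deriv_def by (rule DERIV_imp_deriv)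
qed

lemma column_bound_nonneg: "0 \<le> column_bound f j x"
  by (simp add: column_bound_def sum_nonneg)

lemma column_bound_eq_norm:
  fixes f :: "real ^ 'n \<Rightarrow> real ^ 'g"
  assumes "(f has_derivative f') (at x)"
  shows "(column_bound f j x)\<^sup>2 = real CARD('n) * (norm (f' (axis j 1)))\<^sup>2"
  by (simp add: column_bound_def sum_nonneg has_derivative_partial_deriv[OF assms]
      power2_norm_eq_inner inner_vec_def power2_eq_square [symmetric])

lemma norm_derivative_le_column_bounds:
  fixes f :: "real ^ 'n \<Rightarrow> real ^ 'g"
  assumes "(f has_derivative f') (at y)"
  shows "(norm (f' x))\<^sup>2 \<le> (\<Sum>j\<in>UNIV. (column_bound f j y * x $ j)\<^sup>2)"
proof -
  have lin: "linear f'"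
    using assms by (rule has_derivative_linear)
  have "f' x = f' (\<Sum>j\<in>UNIV. x $ j *\<^sub>R axis j 1)"
    using basis_expansion[of x] by (simp add: scalar_mult_eq_scaleR)
  also have "\<dots> = (\<Sum>j\<in>UNIV. x $ j *\<^sub>R f' (axis j 1))"
    by (simp add: linear_sum[OF lin] linear_scale[OF lin])
  finally have "norm (f' x) \<le> (\<Sum>j\<in>UNIV. \<bar>x $ j\<bar> * norm (f' (axis j 1)))"
    by (auto intro: order_trans[OF norm_sum])
  then have "(norm (f' x))\<^sup>2 \<le> (\<Sum>j\<in>UNIV. \<bar>x $ j\<bar> * norm (f' (axis j 1)))\<^sup>2"
    by (rule power_mono) simp
  \<comment> \<open>Cauchy-Schwarz against the all-ones vector; its factor n is the one under the
    root in \<open>column_bound\<close>.\<close>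
  also have "\<dots> \<le> (\<Sum>j\<in>UNIV. (\<bar>x $ j\<bar> * norm (f' (axis j 1)))\<^sup>2) * real CARD('n)"
    by (rule sum_squared_le_sum_of_squares)
  also have "\<dots> = (\<Sum>j\<in>UNIV. (column_bound f j y * x $ j)\<^sup>2)"
    by (simp add: sum_distrib_left power_mult_distrib column_bound_eq_norm[OF assms] mult_ac)
  finally show ?thesis .
qed

text \<open>\<open>GREATEST\<close> is specified only if a greatest element exists; an attained
  maximum provides one.\<close>

lemma maximum_on_upper:
  assumes "has_maximum_on h X" "y \<in> X"
  shows "h y \<le> maximum_on h X"
proof -
  from assms(1) obtain x where x: "x \<in> X" "\<And>y. y \<in> X \<Longrightarrow> h y \<le> h x"
    unfolding has_maximum_on_def by blast
  then have "maximum_on h X = h x"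
    unfolding maximum_on_def by (intro Greatest_equality) auto
  with x assms(2) show ?thesis by simp
qed

lemma quadratic_form_diag:
  fixes x :: "real ^ 'n"
  shows "x \<bullet> ((transpose (diag d) ** diag d) *v x) = (\<Sum>j\<in>UNIV. (d j * x $ j)\<^sup>2)"
proof -
  have "(diag d *v x) $ j = d j * x $ j" for j
    by (simp add: diag_def matrix_vector_mult_def if_distrib [of "\<lambda>c. c * _"] cong: if_cong)
  \<comment> \<open>Moving the transpose across the inner product turns the form into the squared
    norm of \<open>diag d *v x\<close>.\<close>
  moreover have "x \<bullet> ((transpose (diag d) ** diag d) *v x) = (diag d *v x) \<bullet> (diag d *v x)"
    by (simp add: matrix_vector_mul_assoc [symmetric] dot_lmul_matrix [symmetric] inner_commute)
  ultimately show ?thesis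
    by (simp add: inner_vec_def power2_eq_square)
qed

text \<open>The assumption \<open>origin\<close> puts the segment from 0 to x inside the box. On a
  box away from 0, f could be a nonzero constant, which makes every diagonal entry 0 and the bound
  false.\<close>

theorem theorem5:
  fixes f :: "real ^ 'n \<Rightarrow> real ^ 'g" and a b :: "real ^ 'n" and X :: "(real ^ 'n) set"
  assumes box: "X = cbox a b" and nonempty: "X \<noteq> {}" and origin: "0 \<in> X"
    and C1: "continuously_differentiable_in f X"
    and f0: "f 0 = 0"
  shows "(\<forall>j. has_maximum_on (column_bound f j) X) \<and>
         quadratically_bounded_by (diag (\<lambda>j. maximum_on (column_bound f j) X)) f X"
proof
  have "continuous_on X (column_bound f j)" for j
    using C1 unfolding column_bound_def [abs_def] continuously_differentiable_in_def
    by (auto intro!: continuous_intros)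
  \<comment> \<open>A box is compact, so continuity gives attainment.\<close>
  then show max: "\<forall>j. has_maximum_on (column_bound f j) X"
    using continuous_attains_sup[of X] box nonempty
    unfolding has_maximum_on_def by auto
  from C1 obtain f' where f': "\<And>x. x \<in> X \<Longrightarrow> (f has_derivative f' x) (at x)"
    unfolding continuously_differentiable_in_def differentiable_def by metis
  show "quadratically_bounded_by (diag (\<lambda>j. maximum_on (column_bound f j) X)) f X"
    unfolding quadratically_bounded_by_def quadratic_form_diag
  proof
    fix x assume x: "x \<in> X"
    have seg: "t *\<^sub>R x \<in> X" if "0 \<le> t" "t \<le> 1" for t
      using convexD[OF convex_box(1), of 0 a b x "1 - t" t] that x origin box by simp
    have deriv: "((\<lambda>t. f (t *\<^sub>R x)) has_derivative (\<lambda>s. f' (t *\<^sub>R x) (s *\<^sub>R x))) (at t)"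
      if "0 \<le> t" "t \<le> 1" for t
      by (rule has_derivative_compose[where f = "\<lambda>t. t *\<^sub>R x", OF _ f'[OF seg[OF that]]])
        (auto intro!: derivative_eq_intros)
    have "continuous_on {0..1} (\<lambda>t. f (t *\<^sub>R x))"
      by (intro continuous_at_imp_continuous_on ballI has_derivative_continuous[OF deriv]) auto
    \<comment> \<open>For vector-valued maps only an inequality of norms holds, but a single t
      serves all components of f at once, so whole Jacobian columns at one point can be
      compared.\<close>
    with deriv obtain t where t: "0 < t" "t < 1"
      and "norm (f (1 *\<^sub>R x) - f (0 *\<^sub>R x)) \<le> norm (f' (t *\<^sub>R x) ((1 - 0) *\<^sub>R x))"
      using mvt_general[of 0 1 "\<lambda>t. f (t *\<^sub>R x)" "\<lambda>t s. f' (t *\<^sub>R x) (s *\<^sub>R x)"] by auto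
    then have "norm (f x) \<le> norm (f' (t *\<^sub>R x) x)"
      by (simp add: f0)
    then have "f x \<bullet> f x \<le> (norm (f' (t *\<^sub>R x) x))\<^sup>2"
      by (simp add: power2_norm_eq_inner [symmetric] power_mono)
    also have "\<dots> \<le> (\<Sum>j\<in>UNIV. (column_bound f j (t *\<^sub>R x) * x $ j)\<^sup>2)"
      using t by (intro norm_derivative_le_column_bounds f' seg) auto
    \<comment> \<open>The point t x varies with x; passing to the maxima removes this dependence.
      Squaring preserves the order because \<open>column_bound\<close> is nonnegative.\<close>
    also have "\<dots> \<le> (\<Sum>j\<in>UNIV. (maximum_on (column_bound f j) X * x $ j)\<^sup>2)"
      unfolding power_mult_distrib using t max
      by (intro sum_mono mult_right_mono power_mono maximum_on_upper seg column_bound_nonneg) auto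
    finally show "f x \<bullet> f x \<le> (\<Sum>j\<in>UNIV. (maximum_on (column_bound f j) X * x $ j)\<^sup>2)" .
  qed
qed

end
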